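(* Let $\mathbb{K}$ be a field of characteristic $0$, let $P(x_0,x_1,\ldots,x_k,t,v)$ be a polynomial with coefficients in $\mathbb{K}$, and let $F_1,\ldots,F_k\in\mathbb{K}[[t]]$ and $F(u)\in\mathbb{K}[u][[t]]$ satisfy $$P(F(u),F_1,\ldots,F_k,t,u)=0.$$ Let $P'_0$ denote the derivative of $P$ with respect to $x_0$. Assume that the series $U\in\overline{\mathbb{K}}^{\mathrm{fr}}[[t]]$ is a root of multiplicity $\ell$, with $\ell\ge1$, of the series $P'_0(F(u),F_1,\ldots,F_k,t,u)$ (viewed as a series in $t$ with polynomial coefficients in $u$). Assume also that the degree of $P$ in $x_0$ is at least $2$, and let $\Delta(x_1,\ldots,x_k,t,v)$ be the discriminant of $P$ with respect to $x_0$. Then, as a polynomial in $v$, $\Delta(F_1,\ldots,F_k,t,v)$ admits $U$ as a root of multiplicity at least $2\ell$; that is, for $0\le i\le 2\ell-1$, $$\frac{\partial^i\Delta}{\partial v^i}(F_1,\ldots,F_k,t,U)=0.$$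
   Context: $\overline{\mathbb{K}}$ is an algebraic closure of $\mathbb{K}$. For a field $\mathbb{L}$, $\mathbb{L}^{\mathrm{fr}}[[t]]$ is the ring of fractional power series $\sum_{n\ge0}a_nt^{n/d}$ ($a_n\in\mathbb{L}$, $d$ a positive integer depending on the series), and $\mathbb{L}[u]^{\mathrm{fr}}[[t]]$ is the ring of series $\sum_{n\ge0}t^{n/d}\phi_n(u)$ with $\phi_n(u)\in\mathbb{L}[u]$. For $\Phi\in\mathbb{L}[u]^{\mathrm{fr}}[[t]]$ and $U\in\mathbb{L}^{\mathrm{fr}}[[t]]$, $U$ is a root of $\Phi$ of multiplicity $m$ if $\Phi(t,u)=(u-U)^m\Psi(t,u)$ with $\Psi\in\mathbb{L}[u]^{\mathrm{fr}}[[t]]$ and $\Psi(t,U)\neq0$. If $P=\sum_{j=0}^n a_jx_0^j$ has degree $n$ in $x_0$ (coefficients $a_j$ polynomials in the other variables), its discriminant with respect to $x_0$ is $(-1)^{n(n-1)/2}$ times the determinant of the $(2n-1)\times(2n-1)$ matrix whose first $n-1$ rows are the shifted coefficient rows $(1,a_{n-1},\ldots,a_0,0,\ldots)$, $(0,a_n,a_{n-1},\ldots,a_0,0,\ldots)$, \ldots, $(0,\ldots,0,a_n,\ldots,a_0)$ and whose last $n$ rows are the shifted rows $(n,(n-1)a_{n-1},\ldots,a_1,0,\ldots)$, $(0,na_n,(n-1)a_{n-1},\ldots,a_1,0,\ldots)$, \ldots, $(0,\ldots,0,na_n,\ldots,a_1)$; equivalently $(-1)^{n(n-1)/2}a_n^{-1}\mathrm{Res}_{x_0}(P,\partial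 P/\partial x_0)$ with the resultant computed for formal degrees $n$ and $n-1$. It is a polynomial in $x_1,\ldots,x_k,t,v$. *)

theory Defs
  imports
    "HOL-Library.Poly_Mapping"
    "HOL-Computational_Algebra.Formal_Power_Series"
    "HOL-Algebra.Algebraic_Closure_Type"
    "Jordan_Normal_Form.Determinant"
begin

section \<open>Fractional power series\<close>

text \<open>
  A series \<open>\<Sum>\<^sub>n a\<^sub>n t\<^bsup>n/d\<^esup>\<close> is represented by the function that maps a rational exponent to its
  coefficient. The coefficients may be taken in any type with zero; both rings needed here are
  instances: \<open>L\<^sup>f\<^sup>r[[t]]\<close> is \<open>'a frps\<close> and \<open>L[u]\<^sup>f\<^sup>r[[t]]\<close> is \<open>'a poly frps\<close>.
\<close>

definition has_den :: "nat \<Rightarrow> (rat \<Rightarrow> 'a::zero) \<Rightarrow> bool" where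
  "has_den d f \<longleftrightarrow> d > 0 \<and> (\<forall>q. f q \<noteq> 0 \<longrightarrow> (\<exists>n::nat. q = of_nat n / of_nat d))"

typedef (overloaded) 'a frps = "{f :: rat \<Rightarrow> 'a::zero. \<exists>d. has_den d f}"
  morphisms frps_nth Abs_frps
  by (rule exI[of _ "\<lambda>_. 0"]) (auto simp: has_den_def)

setup_lifting type_definition_frps

lemma has_denD: "has_den d f \<Longrightarrow> f q \<noteq> 0 \<Longrightarrow> \<exists>n::nat. q = of_nat n / of_nat d"
  by (auto simp: has_den_def)

lemma has_den_pos: "has_den d f \<Longrightarrow> d > 0"
  by (auto simp: has_den_def)

lemma has_den_mult_left:
  assumes "has_den d f" "e > 0" shows "has_den (d * e) f"
  unfolding has_den_def
proof (intro conjI allI impI)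
  show "d * e > 0" using assms by (auto simp: has_den_def)
  fix q assume "f q \<noteq> 0"
  then obtain n where n: "q = of_nat n / of_nat d" using assms has_denD by blast
  have "q = of_nat (n * e) / of_nat (d * e)" using n assms(2) by simp
  then show "\<exists>n. q = of_nat n / of_nat (d * e)" by blast
qed

lemma has_den_mult_right:
  "has_den d f \<Longrightarrow> e > 0 \<Longrightarrow> has_den (e * d) f"
  using has_den_mult_left[of d f e] by (simp add: mult.commute)

lemma common_den2: "\<exists>d. has_den d (frps_nth f) \<and> has_den d (frps_nth g)"
proof -
  obtain d where d: "has_den d (frps_nth f)" using frps_nth[of f] by auto
  obtain e where e: "has_den e (frps_nth g)" using frps_nth[of g] by auto
  show ?thesis
    using has_den_mult_left[OF d has_den_pos[OF e]] has_den_mult_right[OF e has_den_pos[OF d]]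
    by blast
qed

lemma common_den3:
  "\<exists>d. has_den d (frps_nth f) \<and> has_den d (frps_nth g) \<and> has_den d (frps_nth h)"
proof -
  obtain d where d: "has_den d (frps_nth f)" "has_den d (frps_nth g)" using common_den2 by blast
  obtain e where e: "has_den e (frps_nth h)" using frps_nth[of h] by auto
  show ?thesis
    using has_den_mult_left[OF d(1) has_den_pos[OF e]] has_den_mult_left[OF d(2) has_den_pos[OF e]]
      has_den_mult_right[OF e has_den_pos[OF d(1)]] by blast
qed

lemma has_den_add:
  fixes f g :: "rat \<Rightarrow> 'a::monoid_add"
  shows "has_den d f \<Longrightarrow> has_den d g \<Longrightarrow> has_den d (\<lambda>q. f q + g q)"
  unfolding has_den_def by (metis add_0)

lemma has_den_uminus:
  fixes f :: "rat \<Rightarrow> 'a::group_add"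
  shows "has_den d f \<Longrightarrow> has_den d (\<lambda>q. - f q)"
  unfolding has_den_def by simp

definition conv :: "(rat \<Rightarrow> 'a::semiring_0) \<Rightarrow> (rat \<Rightarrow> 'a) \<Rightarrow> rat \<Rightarrow> 'a" where
  "conv f g q = (\<Sum>a | f a \<noteq> 0 \<and> g (q - a) \<noteq> 0. f a * g (q - a))"

lemma conv_at:
  assumes f: "has_den d f" and g: "has_den d g"
  shows "conv f g (of_nat n / of_nat d)
       = (\<Sum>i=0..n. f (of_nat i / of_nat d) * g (of_nat (n - i) / of_nat d))"
proof -
  have d: "d > 0" using f by (rule has_den_pos)
  let ?q = "of_nat n / of_nat d :: rat"
  let ?h = "\<lambda>i::nat. of_nat i / of_nat d :: rat"
  let ?S = "{a. f a \<noteq> 0 \<and> g (?q - a) \<noteq> 0}"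
  have inj: "inj_on ?h {0..n}" using d by (auto simp: inj_on_def field_simps)
  have diff: "?q - ?h i = ?h (n - i)" if "i \<le> n" for i
    using that d by (simp add: field_simps of_nat_diff)
  have sub: "?S \<subseteq> ?h ` {0..n}"
  proof
    fix a assume a: "a \<in> ?S"
    then obtain i where i: "a = ?h i" using has_denD[OF f, of a] by auto
    obtain j :: nat where j: "?q - a = ?h j" using a has_denD[OF g, of "?q - a"] by auto
    have "?h n = ?h (i + j)" using i j by (simp add: algebra_simps add_divide_distrib)
    then have "of_nat n = (of_nat (i + j) :: rat)" using d by (simp add: field_simps)
    then have "n = i + j" by (simp only: of_nat_eq_iff)
    then have "i \<le> n" by simp
    with i show "a \<in> ?h ` {0..n}" by auto
  qed
  have "conv f g ?q = (\<Sum>a\<in>?h ` {0..n}. f a * g (?q - a))"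
    unfolding conv_def using sub by (intro sum.mono_neutral_left) auto
  also have "\<dots> = (\<Sum>i=0..n. f (?h i) * g (?q - ?h i))"
    by (simp add: sum.reindex[OF inj])
  also have "\<dots> = (\<Sum>i=0..n. f (?h i) * g (?h (n - i)))"
    by (rule sum.cong) (auto simp: diff)
  finally show ?thesis .
qed

lemma has_den_conv:
  assumes f: "has_den d f" and g: "has_den d g"
  shows "has_den d (conv f g)"
  unfolding has_den_def
proof (intro conjI allI impI)
  show "d > 0" using f by (rule has_den_pos)
  fix q assume "conv f g q \<noteq> 0"
  then obtain a where a: "f a \<noteq> 0" "g (q - a) \<noteq> 0"
    unfolding conv_def using sum.not_neutral_contains_not_neutral by force
  obtain i where i: "a = of_nat i / of_nat d" using has_denD[OF f a(1)] by auto
  obtain j where j: "q - a = of_nat j / of_nat d" using has_denD[OF g a(2)] by auto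
  have "q = of_nat (i + j) / of_nat d" using i j by (simp add: algebra_simps add_divide_distrib)
  then show "\<exists>n. q = of_nat n / of_nat d" by blast
qed

instantiation frps :: (zero) zero
begin
lift_definition zero_frps :: "'a frps" is "\<lambda>_. 0" by (auto simp: has_den_def)
instance ..
end

lift_definition frps_const :: "'a::zero \<Rightarrow> 'a frps" is "\<lambda>c q. if q = 0 then c else 0"
  by (rule exI[of _ 1]) (auto simp: has_den_def intro: exI[of _ 0])

instantiation frps :: (zero_neq_one) one
begin
definition one_frps :: "'a frps" where "one_frps = frps_const 1"
instance ..
end

instantiation frps :: (comm_ring_1) "{plus, minus, uminus, times}"
begin

lift_definition plus_frps :: "'a frps \<Rightarrow> 'a frps \<Rightarrow> 'a frps" is "\<lambda>f g q. f q + g q"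
  by (metis common_den2 Abs_frps_inverse has_den_add mem_Collect_eq)

lift_definition uminus_frps :: "'a frps \<Rightarrow> 'a frps" is "\<lambda>f q. - f q"
  using has_den_uminus by blast

definition minus_frps :: "'a frps \<Rightarrow> 'a frps \<Rightarrow> 'a frps" where
  "minus_frps f g = f + (- g)"

lift_definition times_frps :: "'a frps \<Rightarrow> 'a frps \<Rightarrow> 'a frps" is conv
  by (metis common_den2 Abs_frps_inverse has_den_conv mem_Collect_eq)

instance ..
end

text \<open>The power series in \<open>t\<^bsup>1/d\<^esup>\<close> underlying a fractional series with denominator \<open>d\<close>.\<close>

definition fps_at :: "nat \<Rightarrow> 'a::comm_ring_1 frps \<Rightarrow> 'a fps" where
  "fps_at d f = Abs_fps (\<lambda>n. frps_nth f (of_nat n / of_nat d))"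

lemma fps_at_eqI:
  assumes "has_den d (frps_nth f)" "has_den d (frps_nth g)" "fps_at d f = fps_at d g"
  shows "f = g"
proof -
  have *: "frps_nth f (of_nat n / of_nat d) = frps_nth g (of_nat n / of_nat d)" for n
    using arg_cong[OF assms(3), of "\<lambda>h. fps_nth h n"] by (simp add: fps_at_def)
  have "frps_nth f q = frps_nth g q" for q
    using has_denD[OF assms(1), of q] has_denD[OF assms(2), of q] * by metis
  then show ?thesis by (simp add: frps_nth_inject[symmetric] fun_eq_iff)
qed

lemma has_den_frps_mult:
  "has_den d (frps_nth f) \<Longrightarrow> has_den d (frps_nth g) \<Longrightarrow> has_den d (frps_nth (f * g))"
  by transfer (rule has_den_conv)

lemma has_den_frps_add:
  "has_den d (frps_nth f) \<Longrightarrow> has_den d (frps_nth g) \<Longrightarrow> has_den d (frps_nth (f + g))"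
  by transfer (rule has_den_add)

lemma has_den_frps_const: "d > 0 \<Longrightarrow> has_den d (frps_nth (frps_const c))"
  by transfer (auto simp: has_den_def intro: exI[of _ 0])

lemma fps_at_mult:
  "has_den d (frps_nth f) \<Longrightarrow> has_den d (frps_nth g) \<Longrightarrow> fps_at d (f * g) = fps_at d f * fps_at d g"
  by (rule fps_ext) (simp add: fps_at_def fps_mult_nth times_frps.rep_eq conv_at)

lemma fps_at_add: "fps_at d (f + g) = fps_at d f + fps_at d g"
  by (rule fps_ext) (simp add: fps_at_def plus_frps.rep_eq)

lemma fps_at_const: "d > 0 \<Longrightarrow> fps_at d (frps_const c) = fps_const c"
  by (rule fps_ext) (simp add: fps_at_def frps_const.rep_eq)

instance frps :: (comm_ring_1) comm_ring_1
proof
  fix a b c :: "'a frps"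
  show "a + b + c = a + (b + c)" by transfer (simp add: add.assoc)
  show "a + b = b + a" by transfer (simp add: add.commute)
  show "0 + a = a" by transfer simp
  show "- a + a = 0" by transfer simp
  show "a - b = a + - b" by (simp add: minus_frps_def)
  show "a * b * c = a * (b * c)"
  proof -
    obtain d where d: "has_den d (frps_nth a)" "has_den d (frps_nth b)" "has_den d (frps_nth c)"
      using common_den3 by blast
    show ?thesis
      using d by (intro fps_at_eqI[of d]) (simp_all add: has_den_frps_mult fps_at_mult mult.assoc)
  qed
  show "a * b = b * a"
  proof -
    obtain d where d: "has_den d (frps_nth a)" "has_den d (frps_nth b)" using common_den2 by blast
    show ?thesis
      using d by (intro fps_at_eqI[of d]) (simp_all add: has_den_frps_mult fps_at_mult mult.commute)
  qed
  show "1 * a = a"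
  proof -
    obtain d where d: "has_den d (frps_nth a)" using frps_nth[of a] by auto
    note p = has_den_pos[OF d]
    show ?thesis
      using d p unfolding one_frps_def
      by (intro fps_at_eqI[of d])
        (simp_all add: has_den_frps_mult has_den_frps_const fps_at_mult fps_at_const)
  qed
  show "(a + b) * c = a * c + b * c"
  proof -
    obtain d where d: "has_den d (frps_nth a)" "has_den d (frps_nth b)" "has_den d (frps_nth c)"
      using common_den3 by blast
    show ?thesis
      using d by (intro fps_at_eqI[of d])
        (simp_all add: has_den_frps_mult has_den_frps_add fps_at_mult fps_at_add distrib_right)
  qed
  have "frps_nth (0 :: 'a frps) 0 \<noteq> frps_nth 1 0"
    by (simp add: zero_frps.rep_eq one_frps_def frps_const.rep_eq)
  then show "(0 :: 'a frps) \<noteq> 1" by metis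
qed

text \<open>
  An ordinary power series as a fractional one, with \<open>h\<close> applied to every coefficient; \<open>h\<close> will be
  the embedding of the field into its algebraic closure or the induced map on polynomials.
\<close>

lift_definition frps_of_fps :: "('a \<Rightarrow> 'b::zero) \<Rightarrow> 'a fps \<Rightarrow> 'b frps" is
  "\<lambda>h f q. if q \<in> \<nat> then h (fps_nth f (nat \<lfloor>q\<rfloor>)) else 0"
  by (rule exI[of _ 1]) (auto simp: has_den_def Nats_def)

text \<open>The inclusion of \<open>L\<^sup>f\<^sup>r[[t]]\<close> into \<open>L[u]\<^sup>f\<^sup>r[[t]]\<close>.\<close>

lift_definition frps_to_poly :: "'a::zero frps \<Rightarrow> 'a poly frps" is "\<lambda>f q. [:f q:]"
  by (auto simp: has_den_def)

abbreviation frps_t :: "'a::comm_ring_1 frps" where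
  "frps_t \<equiv> frps_of_fps id fps_X"

text \<open>
  Substitution of \<open>U\<close> for \<open>u\<close>: if \<open>\<Phi> = \<Sum>\<^sub>q t\<^sup>q \<phi>\<^sub>q(u)\<close>, the coefficient of \<open>t\<^sup>r\<close> in
  \<open>\<Phi>(t,U) = \<Sum>\<^sub>q t\<^sup>q \<phi>\<^sub>q(U)\<close> only receives contributions from the finitely many exponents \<open>q \<le> r\<close>,
  because \<open>\<phi>\<^sub>q(U)\<close> has no negative exponents.
\<close>

lemma has_den_frps_poly:
  assumes U: "has_den d (frps_nth U)"
  shows "has_den d (frps_nth (poly (map_poly frps_const p) U))"
proof -
  note d = has_den_pos[OF U]
  have "has_den d (frps_nth (poly q U))" if "\<forall>i. has_den d (frps_nth (Polynomial.coeff q i))" for q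
    using that
  proof (induction q)
    case 0
    then show ?case using d by (simp add: zero_frps.rep_eq has_den_def)
  next
    case (pCons a q)
    have "\<forall>i. has_den d (frps_nth (Polynomial.coeff q i))"
      using pCons.prems by (metis coeff_pCons_Suc)
    moreover have "has_den d (frps_nth a)" using pCons.prems by (metis coeff_pCons_0)
    ultimately show ?case using pCons.IH U by (simp add: has_den_frps_add has_den_frps_mult)
  qed
  moreover have "frps_const 0 = (0 :: 'a frps)" by transfer auto
  then have "\<forall>i. has_den d (frps_nth (Polynomial.coeff (map_poly frps_const p) i))"
    by (simp add: coeff_map_poly has_den_frps_const[OF d])
  ultimately show ?thesis by blast
qed

lift_definition frps_subst :: "'a::comm_ring_1 poly frps \<Rightarrow> 'a frps \<Rightarrow> 'a frps" is
  "\<lambda>\<Phi> U r. \<Sum>q | q \<le> r \<and> \<Phi> q \<noteq> 0.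
     frps_nth (poly (map_poly frps_const (\<Phi> q)) (Abs_frps U)) (r - q)"
proof -
  fix \<Phi> :: "rat \<Rightarrow> 'a poly" and U :: "rat \<Rightarrow> 'a"
  assume \<Phi>: "\<exists>d. has_den d \<Phi>" and U: "\<exists>d. has_den d U"
  have U': "frps_nth (Abs_frps U) = U" using U by (simp add: Abs_frps_inverse)
  obtain d1 where d1: "has_den d1 \<Phi>" using \<Phi> by blast
  obtain d2 where d2: "has_den d2 U" using U by blast
  define d where "d = d1 * d2"
  have d: "has_den d \<Phi>" "has_den d (frps_nth (Abs_frps U))"
    unfolding d_def U' using has_den_mult_left[OF d1 has_den_pos[OF d2]]
      has_den_mult_right[OF d2 has_den_pos[OF d1]] by blast+
  show "\<exists>d. has_den d (\<lambda>r. \<Sum>q | q \<le> r \<and> \<Phi> q \<noteq> 0.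
          frps_nth (poly (map_poly frps_const (\<Phi> q)) (Abs_frps U)) (r - q))"
  proof (rule exI[of _ d], unfold has_den_def, intro conjI allI impI)
    show "d > 0" using d(1) by (rule has_den_pos)
    fix r assume "(\<Sum>q | q \<le> r \<and> \<Phi> q \<noteq> 0.
          frps_nth (poly (map_poly frps_const (\<Phi> q)) (Abs_frps U)) (r - q)) \<noteq> 0"
    then obtain q where q: "\<Phi> q \<noteq> 0"
      "frps_nth (poly (map_poly frps_const (\<Phi> q)) (Abs_frps U)) (r - q) \<noteq> 0"
      using sum.not_neutral_contains_not_neutral by force
    obtain i where i: "q = of_nat i / of_nat d" using has_denD[OF d(1) q(1)] by auto
    obtain j where j: "r - q = of_nat j / of_nat d"
      using has_denD[OF has_den_frps_poly[OF d(2)] q(2)] by auto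
    have "r = of_nat (i + j) / of_nat d"
      using i j by (simp add: algebra_simps add_divide_distrib)
    then show "\<exists>n. r = of_nat n / of_nat d" by blast
  qed
qed

definition frps_root_of_mult :: "'a::comm_ring_1 poly frps \<Rightarrow> 'a frps \<Rightarrow> nat \<Rightarrow> bool" where
  "frps_root_of_mult \<Phi> U m \<longleftrightarrow>
     (\<exists>\<Psi>. \<Phi> = (frps_const [:0, 1:] - frps_to_poly U) ^ m * \<Psi> \<and> frps_subst \<Psi> U \<noteq> 0)"


section \<open>Polynomials in \<open>x\<^sub>0, x\<^sub>1, \<dots>, x\<^sub>k, t, v\<close>\<close>

datatype ctvar = Xvar nat | Tvar | Vvar

type_synonym 'a mpoly = "(ctvar \<Rightarrow>\<^sub>0 nat) \<Rightarrow>\<^sub>0 'a"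

definition mpoly_vars :: "'a::zero mpoly \<Rightarrow> ctvar set" where
  "mpoly_vars P = (\<Union>m\<in>Poly_Mapping.keys P. Poly_Mapping.keys m)"

text \<open>
  Evaluation of a polynomial at \<open>\<sigma>\<close> in an algebra over the coefficient ring with structure map \<open>h\<close>.
\<close>

definition mpoly_eval :: "('a::zero \<Rightarrow> 'b::comm_semiring_1) \<Rightarrow> (ctvar \<Rightarrow> 'b) \<Rightarrow> 'a mpoly \<Rightarrow> 'b" where
  "mpoly_eval h \<sigma> P = (\<Sum>m\<in>Poly_Mapping.keys P.
     h (Poly_Mapping.lookup P m) * (\<Prod>x\<in>Poly_Mapping.keys m. \<sigma> x ^ Poly_Mapping.lookup m x))"

definition mpoly_deriv :: "ctvar \<Rightarrow> 'a::comm_semiring_1 mpoly \<Rightarrow> 'a mpoly" where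
  "mpoly_deriv x P = (\<Sum>m\<in>Poly_Mapping.keys P.
     Poly_Mapping.single (m - Poly_Mapping.single x 1) (of_nat (Poly_Mapping.lookup m x) * Poly_Mapping.lookup P m))"

definition mpoly_degree :: "ctvar \<Rightarrow> 'a::zero mpoly \<Rightarrow> nat" where
  "mpoly_degree x P = Max (insert 0 ((\<lambda>m. Poly_Mapping.lookup m x) ` Poly_Mapping.keys P))"

text \<open>The coefficient of \<open>x\<^sup>j\<close>, a polynomial in the other variables.\<close>

definition mpoly_coeff :: "ctvar \<Rightarrow> 'a::comm_monoid_add mpoly \<Rightarrow> nat \<Rightarrow> 'a mpoly" where
  "mpoly_coeff x P j = (\<Sum>m | m \<in> Poly_Mapping.keys P \<and> Poly_Mapping.lookup m x = j.
     Poly_Mapping.single (m - Poly_Mapping.single x j) (Poly_Mapping.lookup P m))"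

text \<open>
  The Sylvester matrix of \<open>\<Sum>\<^sub>j a\<^sub>j x\<^sup>j\<close> (of formal degree \<open>n\<close>) and its derivative, with the first
  column, whose only nonzero entries are \<open>a\<^sub>n\<close> and \<open>n a\<^sub>n\<close>, divided by \<open>a\<^sub>n\<close>.
\<close>

definition disc_mat :: "nat \<Rightarrow> (nat \<Rightarrow> 'a::comm_ring_1) \<Rightarrow> 'a mat" where
  "disc_mat n a = mat (2 * n - 1) (2 * n - 1) (\<lambda>(i, j).
     if i < n - 1 then
       (if i = 0 \<and> j = 0 then 1
        else if i \<le> j \<and> j \<le> i + n then a (n - (j - i)) else 0)
     else
       (let i' = i - (n - 1) in
        if i' = 0 \<and> j = 0 then of_nat n
        else if i' \<le> j \<and> j \<le> i' + (n - 1) then of_nat (n - (j - i')) * a (n - (j - i')) else 0))"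

definition mpoly_disc :: "ctvar \<Rightarrow> 'a::comm_ring_1 mpoly \<Rightarrow> 'a mpoly" where
  "mpoly_disc x P = (let n = mpoly_degree x P in
     (-1) ^ (n * (n - 1) div 2) * det (disc_mat n (mpoly_coeff x P)))"

text \<open>
  The assignment \<open>x\<^sub>0 \<mapsto> a\<close>, \<open>x\<^sub>i \<mapsto> f i\<close> for \<open>i \<ge> 1\<close>, \<open>t \<mapsto> b\<close>, \<open>v \<mapsto> c\<close>.
\<close>

fun assign :: "'b \<Rightarrow> (nat \<Rightarrow> 'b) \<Rightarrow> 'b \<Rightarrow> 'b \<Rightarrow> ctvar \<Rightarrow> 'b" where
  "assign a f b c (Xvar i) = (if i = 0 then a else f i)"
| "assign a f b c Tvar = b"
| "assign a f b c Vvar = c"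

text \<open>
  \<open>Q(F(u), F\<^sub>1, \<dots>, F\<^sub>k, t, u)\<close> in \<open>K[u][[t]]\<close>.
\<close>

definition eval_at_series ::
  "'a::comm_ring_1 poly fps \<Rightarrow> (nat \<Rightarrow> 'a fps) \<Rightarrow> 'a mpoly \<Rightarrow> 'a poly fps" where
  "eval_at_series F Fs = mpoly_eval (\<lambda>c. fps_const [:c:])
     (assign F (\<lambda>i. Abs_fps (\<lambda>n. [:fps_nth (Fs i) n:])) fps_X (fps_const [:0, 1:]))"

text \<open>
  For \<open>Q\<close> not involving \<open>x\<^sub>0\<close> (which is sent to 0): \<open>Q(F\<^sub>1, \<dots>, F\<^sub>k, t, V)\<close> in the ring of
  fractional series over the algebraic closure, and \<open>Q(F\<^sub>1, \<dots>, F\<^sub>k, t, v)\<close> as a polynomial in \<open>v\<close>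
  over that ring.
\<close>

definition eval_cat ::
  "(nat \<Rightarrow> 'a::field fps) \<Rightarrow> 'a alg_closure frps \<Rightarrow> 'a mpoly \<Rightarrow> 'a alg_closure frps" where
  "eval_cat Fs V = mpoly_eval (\<lambda>c. frps_const (to_ac c))
     (assign 0 (\<lambda>i. frps_of_fps to_ac (Fs i)) frps_t V)"

definition eval_cat_poly ::
  "(nat \<Rightarrow> 'a::field fps) \<Rightarrow> 'a mpoly \<Rightarrow> 'a alg_closure frps poly" where
  "eval_cat_poly Fs = mpoly_eval (\<lambda>c. [:frps_const (to_ac c):])
     (assign 0 (\<lambda>i. [:frps_of_fps to_ac (Fs i):]) [:frps_t:] [:0, 1:])"

end

theory Submission
  imports Defs "Jordan_Normal_Form.Char_Poly"
begin

text \<open>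
  If a polynomial \<open>p\<close> over any commutative ring has a root \<open>f\<close>, its discriminant is a multiple of
  \<open>p'(f)\<^sup>2\<close>. With \<open>f = F(u)\<close> this makes \<open>\<Delta>(F\<^sub>1, \<dots>, F\<^sub>k, t, u)\<close> a multiple of \<open>(u - U)\<^bsup>2l\<^esup>\<close> in
  \<open>L[u]\<^sup>f\<^sup>r[[t]]\<close>, where \<open>L\<close> is the algebraic closure. The quotient lies in \<open>L\<^sup>f\<^sup>r[[t]][u]\<close>, because a
  remainder that is constant in \<open>u\<close> cannot be a nonzero multiple of \<open>u - U\<close>.
\<close>

section \<open>A double factor of the discriminant\<close>

text \<open>Column \<open>j\<close> stands for the monomial of degree \<open>2 * n - 2 - j\<close>,
  and row \<open>i\<close> lists the coefficients of x^(n-2-i) p. The function \<open>g\<close> is a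
  linear functional on polynomials, given by its values on monomials and applied here to that row.
  The factor \<open>a n\<close> at \<open>j = 0\<close> restores what \<open>disc_mat\<close>
  divides out of its first column.\<close>

lemma disc_mat_row_poly:
  fixes a g :: "nat \<Rightarrow> 'a::comm_ring_1"
  assumes i: "i < n - 1"
  shows "(\<Sum>j<2 * n - 1. disc_mat n a $$ (i, j) * ((if j = 0 then a n else 1) * g (2 * n - 2 - j)))
       = (\<Sum>m\<le>n. a m * g (m + (n - 2 - i)))"
proof -
  let ?t = "\<lambda>j. a (n - (j - i)) * g (2 * n - 2 - j)"
  have "disc_mat n a $$ (i, j) * ((if j = 0 then a n else 1) * g (2 * n - 2 - j))
      = (if j \<in> {i..i + n} then ?t j else 0)" if "j < 2 * n - 1" for j
    using that i by (auto simp: disc_mat_def)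
  then have "(\<Sum>j<2 * n - 1. disc_mat n a $$ (i, j) * ((if j = 0 then a n else 1) * g (2 * n - 2 - j)))
      = (\<Sum>j<2 * n - 1. if j \<in> {i..i + n} then ?t j else 0)"
    by (intro sum.cong) auto
  also have "\<dots> = (\<Sum>j\<in>{i..i + n}. ?t j)"
  proof -
    have sub: "{..<2 * n - 1} \<inter> {i..i + n} = {i..i + n}" using i by auto
    show ?thesis
      by (rule sum.inter_restrict[of "{..<2 * n - 1}" ?t "{i..i + n}", OF finite_lessThan,
            symmetric, unfolded sub])
  qed
  also have "\<dots> = (\<Sum>m\<le>n. a m * g (m + (n - 2 - i)))"
    using i by (intro sum.reindex_bij_witness[of _ "\<lambda>m. i + n - m" "\<lambda>j. i + n - j"])
      (auto intro!: arg_cong2[of _ _ _ _ "(*)"] arg_cong[of _ _ a] arg_cong[of _ _ g])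
  finally show ?thesis .
qed

text \<open>The same pairing for the lower rows, which list the coefficients of x^(2n-2-r)
  p'.\<close>

lemma disc_mat_row_deriv:
  fixes a g :: "nat \<Rightarrow> 'a::comm_ring_1"
  assumes r: "n - 1 \<le> r" "r < 2 * n - 1"
  shows "(\<Sum>j<2 * n - 1. disc_mat n a $$ (r, j) * ((if j = 0 then a n else 1) * g (2 * n - 2 - j)))
       = (\<Sum>m\<le>n. of_nat m * a m * g (m - 1 + (2 * n - 2 - r)))"
proof -
  define i where "i = r - (n - 1)"
  have i: "r = i + (n - 1)" "i < n" using r by (auto simp: i_def)
  let ?t = "\<lambda>j. of_nat (n - (j - i)) * a (n - (j - i)) * g (2 * n - 2 - j)"
  have "disc_mat n a $$ (r, j) * ((if j = 0 then a n else 1) * g (2 * n - 2 - j))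
      = (if j \<in> {i..i + (n - 1)} then ?t j else 0)" if "j < 2 * n - 1" for j
    using that i by (auto simp: disc_mat_def)
  then have "(\<Sum>j<2 * n - 1. disc_mat n a $$ (r, j) * ((if j = 0 then a n else 1) * g (2 * n - 2 - j)))
      = (\<Sum>j<2 * n - 1. if j \<in> {i..i + (n - 1)} then ?t j else 0)"
    by (intro sum.cong) auto
  also have "\<dots> = (\<Sum>j\<in>{i..i + (n - 1)}. ?t j)"
  proof -
    have sub: "{..<2 * n - 1} \<inter> {i..i + (n - 1)} = {i..i + (n - 1)}" using i by auto
    show ?thesis
      by (rule sum.inter_restrict[of "{..<2 * n - 1}" ?t "{i..i + (n - 1)}", OF finite_lessThan,
            symmetric, unfolded sub])
  qed
  also have "\<dots> = (\<Sum>m\<in>{1..n}. of_nat m * a m * g (m - 1 + (2 * n - 2 - r)))"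
    using i by (intro sum.reindex_bij_witness[of _ "\<lambda>m. i + n - m" "\<lambda>j. i + n - j"])
      (auto intro!: arg_cong2[of _ _ _ _ "(*)"] arg_cong[of _ _ a] arg_cong[of _ _ g]
        arg_cong[of _ _ of_nat])
  \<comment> \<open>The term at \<open>m = 0\<close> carries the factor 0, so its truncated
    \<open>m - 1\<close> does no harm.\<close>
  also have "\<dots> = (\<Sum>m\<le>n. of_nat m * a m * g (m - 1 + (2 * n - 2 - r)))"
    by (intro sum.mono_neutral_left) (auto simp: Suc_le_eq)
  finally show ?thesis .
qed

text \<open>Leibniz rule for \<open>f ^ m * f ^ e\<close>. A truncated exponent always comes with
  the factor 0.\<close>

lemma deriv_power_add:
  fixes f :: "'a::comm_semiring_1"
  shows "of_nat (m + e) * f ^ (m + e - 1)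
       = f ^ e * (of_nat m * f ^ (m - 1)) + of_nat e * f ^ (e - 1) * f ^ m"
proof (cases m; cases e)
  fix m' e' assume "m = Suc m'" "e = Suc e'"
  then show ?thesis by (simp add: power_add algebra_simps)
qed (auto simp: algebra_simps)

text \<open>
  Row \<open>r\<close> of the matrix lists the coefficients of \<open>x\<^sup>i p\<close> or \<open>x\<^sup>i p'\<close>. Column operations turn
  the last two columns into the values of these polynomials at \<open>f\<close> and of their derivatives at
  \<open>f\<close>. As \<open>p(f) = 0\<close>, both are multiples of \<open>p'(f)\<close> modulo \<open>p''(f)\<close> times the last column
  divided by \<open>p'(f)\<close>.
\<close>

lemma square_dvd_det_disc_mat:
  fixes a :: "nat \<Rightarrow> 'a::comm_ring_1"
  assumes n: "n \<ge> 2" and root: "(\<Sum>m\<le>n. a m * f ^ m) = 0"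
  shows "(\<Sum>m\<le>n. of_nat m * a m * f ^ (m - 1))\<^sup>2 dvd det (disc_mat n a)"
proof -
  define N where "N = 2 * n - 1"
  define M where "M = disc_mat n a"
  \<comment> \<open>\<open>w\<close> is p'(f) and \<open>w2\<close> is p''(f).\<close>
  define w where "w = (\<Sum>m\<le>n. of_nat m * a m * f ^ (m - 1))"
  define w2 where "w2 = (\<Sum>m\<le>n. of_nat m * a m * (of_nat (m - 1) * f ^ (m - 1 - 1)))"
  define s where "s = (\<lambda>j::nat. if j = 0 then a n else 1)"
  \<comment> \<open>Multiplying by \<open>C\<close> on the right keeps all columns but the last two.
    The last one becomes the row functional x^e -> f^e, the one before it x^e -> e f^(e-1).\<close>
  define C where "C = mat N N (\<lambda>(j, c).
    if c = N - 1 then s j * f ^ (2 * n - 2 - j)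
    else if c = N - 2 then s j * (of_nat (2 * n - 2 - j) * f ^ (2 * n - 2 - j - 1))
    else if j = c then 1 else 0)"
  \<comment> \<open>The ring may have zero divisors, so \<open>w\<close> is not cancelled but
    exhibited by \<open>M * C = B * E\<close>. The last column of \<open>M * C\<close> is
    \<open>w\<close> times that of \<open>B\<close>; the one before it is \<open>w\<close> times its
    counterpart in \<open>B\<close> plus \<open>w2\<close> times the last column of
    \<open>B\<close>. \<open>E\<close> holds these multipliers and is lower triangular.\<close>
  define B where "B = mat N N (\<lambda>(r, c).
    if c = N - 1 then if r < n - 1 then 0 else f ^ (2 * n - 2 - r)
    else if c = N - 2 then
      if r < n - 1 then f ^ (n - 2 - r) else of_nat (2 * n - 2 - r) * f ^ (2 * n - 2 - r - 1)
    else M $$ (r, c))"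
  define E where "E = mat N N (\<lambda>(r, c).
    if r = c then if N - 2 \<le> c then w else 1
    else if r = N - 1 \<and> c = N - 2 then w2 else 0)"
  have M: "M \<in> carrier_mat N N" by (simp add: M_def N_def disc_mat_def)
  have C: "C \<in> carrier_mat N N" and B: "B \<in> carrier_mat N N" and E: "E \<in> carrier_mat N N"
    by (simp_all add: C_def B_def E_def)
  have N: "N \<ge> 3" "N - 1 = 2 * n - 2" "N - Suc 0 = 2 * n - 2" "N - 2 = 2 * n - 3" "2 * n - 3 \<noteq> 2 * n - 2"
    using n by (auto simp: N_def)
  have detC: "det C = 1"
  proof -
    have "upper_triangular C"
      using N by (intro upper_triangularI) (auto simp: C_def)
    then have "det C = prod_list (diag_mat C)"
      using C by (rule det_upper_triangular)
    also have "\<dots> = (\<Prod>i = 0..<N. C $$ (i, i))"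
      using C by (simp add: prod_list_diag_prod)
    also have "\<dots> = 1"
    proof -
      \<comment> \<open>The diagonal entry of \<open>C\<close> in column \<open>N - 2\<close> is the
        derivative of x^1, and the last one is \<open>f ^ 0\<close>. Both lie in rows
        \<open>j > 0\<close> because \<open>n \<ge> 2\<close>, so \<open>s j = 1\<close>
        there.\<close>
      have "2 * n - Suc (Suc (2 * n - 3)) = 1" using n by simp
      then show ?thesis using N n by (intro prod.neutral) (auto simp: C_def s_def)
    qed
    finally show ?thesis .
  qed
  have detE: "det E = w\<^sup>2"
  proof -
    have "det E = prod_list (diag_mat E)"
      using N by (intro det_lower_triangular[OF _ E]) (auto simp: E_def)
    also have "\<dots> = (\<Prod>i = 0..<N. E $$ (i, i))"
      using E by (simp add: prod_list_diag_prod)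
    also have "\<dots> = (\<Prod>i = 0..<N. if i \<in> {N - 2..N - 1} then w else 1)"
      using N by (intro prod.cong) (auto simp: E_def)
    also have "\<dots> = (\<Prod>i\<in>{N - 2..N - 1}. w)"
    proof -
      have "{0..<N} \<inter> {N - 2..N - 1} = {N - 2..N - 1}" using N(1) by auto
      then show ?thesis
        using prod.inter_restrict[of "{0..<N}" "\<lambda>_. w" "{N - 2..N - 1}"] by simp
    qed
    also have "\<dots> = w ^ card {N - 2..N - 1}" by simp
    also have "card {N - 2..N - 1} = 2" using N(1) by simp
    finally show ?thesis .
  qed
  have MC: "(M * C) $$ (r, c) = (\<Sum>j<N. M $$ (r, j) * C $$ (j, c))" if "r < N" "c < N" for r c
    using that M C by (auto simp: scalar_prod_def atLeast0LessThan intro!: sum.cong)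
  have BE: "(B * E) $$ (r, c) = (\<Sum>j<N. B $$ (r, j) * E $$ (j, c))" if "r < N" "c < N" for r c
    using that B E by (auto simp: scalar_prod_def atLeast0LessThan intro!: sum.cong)
  have row_poly: "(\<Sum>j<N. M $$ (r, j) * (s j * g (2 * n - 2 - j)))
      = (\<Sum>m\<le>n. a m * g (m + (n - 2 - r)))" if "r < n - 1" for r g
    unfolding M_def N_def s_def using that by (rule disc_mat_row_poly)
  have row_deriv: "(\<Sum>j<N. M $$ (r, j) * (s j * g (2 * n - 2 - j)))
      = (\<Sum>m\<le>n. of_nat m * a m * g (m - 1 + (2 * n - 2 - r)))" if "n - 1 \<le> r" "r < N" for r g
    unfolding M_def N_def s_def using that unfolding N_def by (rule disc_mat_row_deriv)
  have "M * C = B * E"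
  proof (rule eq_matI)
    fix r c assume "r < dim_row (B * E)" "c < dim_col (B * E)"
    then have r: "r < N" and c: "c < N" using B E by auto
    consider "c = N - 1" | "c = N - 2" | "c < N - 2" using c by linarith
    then show "(M * C) $$ (r, c) = (B * E) $$ (r, c)"
    proof cases
      case 1
      have "(B * E) $$ (r, c) = (\<Sum>j<N. if j = N - 1 then B $$ (r, N - 1) * w else 0)"
        unfolding BE[OF r c] using 1 N by (intro sum.cong) (auto simp: E_def)
      also have "\<dots> = B $$ (r, N - 1) * w" using N by simp
      finally have be: "(B * E) $$ (r, c) = B $$ (r, N - 1) * w" .
      have mc: "(M * C) $$ (r, c) = (\<Sum>j<N. M $$ (r, j) * (s j * f ^ (2 * n - 2 - j)))"
        unfolding MC[OF r c] using 1 N by (intro sum.cong) (auto simp: C_def)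
      show ?thesis
      proof (cases "r < n - 1")
        case True
        \<comment> \<open>The value of x^(n-2-r) p at f is a multiple of p(f) = 0.\<close>
        have "(M * C) $$ (r, c) = f ^ (n - 2 - r) * (\<Sum>m\<le>n. a m * f ^ m)"
          unfolding mc row_poly[OF True, of "\<lambda>e. f ^ e"]
          by (simp add: sum_distrib_left power_add mult_ac)
        then show ?thesis using be True r N root by (simp add: B_def)
      next
        case False
        then have "n - 1 \<le> r" by simp
        have "(M * C) $$ (r, c) = f ^ (2 * n - 2 - r) * w"
          unfolding mc row_deriv[OF \<open>n - 1 \<le> r\<close> r, of "\<lambda>e. f ^ e"] w_def
          by (simp add: sum_distrib_left power_add mult_ac)
        then show ?thesis using be False r N by (simp add: B_def)
      qed
    next
      case 2
      have "(B * E) $$ (r, c) = (\<Sum>j<N. (if j = N - 2 then B $$ (r, N - 2) * w else 0) +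
          (if j = N - 1 then B $$ (r, N - 1) * w2 else 0))"
        unfolding BE[OF r c] using 2 N n by (intro sum.cong) (auto simp: E_def)
      also have "\<dots> = B $$ (r, N - 2) * w + B $$ (r, N - 1) * w2"
        using N(1) by (simp add: sum.distrib)
      finally have be: "(B * E) $$ (r, c) = B $$ (r, N - 2) * w + B $$ (r, N - 1) * w2" .
      have mc: "(M * C) $$ (r, c) = (\<Sum>j<N. M $$ (r, j) *
          (s j * (\<lambda>e. of_nat e * f ^ (e - 1)) (2 * n - 2 - j)))"
        unfolding MC[OF r c] using 2 N n by (intro sum.cong) (auto simp: C_def)
      show ?thesis
      proof (cases "r < n - 1")
        case True
        define e where "e = n - 2 - r"
        \<comment> \<open>The derivative of x^e p at f: the Leibniz rule gives f^e p'(f) + e f^(e-1)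
          p(f), and the second term vanishes.\<close>
        have "(M * C) $$ (r, c) = (\<Sum>m\<le>n. a m * (of_nat (m + e) * f ^ (m + e - 1)))"
          unfolding mc row_poly[OF True, of "\<lambda>e. of_nat e * f ^ (e - 1)"] e_def ..
        also have "\<dots> = f ^ e * w + of_nat e * f ^ (e - 1) * (\<Sum>m\<le>n. a m * f ^ m)"
          unfolding deriv_power_add w_def
          by (simp add: sum_distrib_left sum.distrib distrib_left mult_ac)
        finally show ?thesis using be True r N root n by (simp add: B_def e_def)
      next
        case False
        then have "n - 1 \<le> r" by simp
        define e where "e = 2 * n - 2 - r"
        \<comment> \<open>The derivative of x^e p' at f is f^e p''(f) + e f^(e-1) p'(f). The first
          summand is \<open>w2\<close> times the entry of \<open>B\<close> in the last
          column.\<close>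
        have "(M * C) $$ (r, c)
            = (\<Sum>m\<le>n. of_nat m * a m * (of_nat (m - 1 + e) * f ^ (m - 1 + e - 1)))"
          unfolding mc row_deriv[OF \<open>n - 1 \<le> r\<close> r, of "\<lambda>e. of_nat e * f ^ (e - 1)"] e_def ..
        also have "\<dots> = f ^ e * w2 + of_nat e * f ^ (e - 1) * w"
          unfolding deriv_power_add w_def w2_def
          by (simp add: sum_distrib_left sum.distrib distrib_left mult_ac)
        finally show ?thesis using be False r N n by (simp add: B_def e_def add.commute)
      qed
    next
      case 3
      have "(M * C) $$ (r, c) = (\<Sum>j<N. if j = c then M $$ (r, c) else 0)"
        unfolding MC[OF r c] using 3 c by (intro sum.cong) (auto simp: C_def)
      moreover have "(B * E) $$ (r, c) = (\<Sum>j<N. if j = c then B $$ (r, c) else 0)"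
        unfolding BE[OF r c] using 3 c by (intro sum.cong) (auto simp: E_def)
      ultimately show ?thesis using 3 r c by (simp add: B_def)
    qed
  qed (use M C B E in auto)
  then have "det M * det C = det B * det E"
    using M C B E by (metis det_mult)
  then have "det M = det B * w\<^sup>2" by (simp add: detC detE)
  then show ?thesis by (simp add: M_def w_def)
qed


section \<open>Evaluation of multivariate polynomials\<close>

definition monom_eval :: "(ctvar \<Rightarrow> 'b::comm_semiring_1) \<Rightarrow> (ctvar \<Rightarrow>\<^sub>0 nat) \<Rightarrow> 'b" where
  "monom_eval \<sigma> m = (\<Prod>x\<in>Poly_Mapping.keys m. \<sigma> x ^ Poly_Mapping.lookup m x)"

lemma monom_eval_superset:
  assumes "finite S" "Poly_Mapping.keys m \<subseteq> S"
  shows "monom_eval \<sigma> m = (\<Prod>x\<in>S. \<sigma> x ^ Poly_Mapping.lookup m x)"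
  unfolding monom_eval_def using assms by (intro prod.mono_neutral_left) (auto simp: in_keys_iff)

lemma monom_eval_0 [simp]: "monom_eval \<sigma> 0 = 1"
  by (simp add: monom_eval_def)

lemma monom_eval_add: "monom_eval \<sigma> (m + m') = monom_eval \<sigma> m * monom_eval \<sigma> m'"
proof -
  let ?S = "Poly_Mapping.keys m \<union> Poly_Mapping.keys m'"
  have "monom_eval \<sigma> (m + m') = (\<Prod>x\<in>?S. \<sigma> x ^ Poly_Mapping.lookup (m + m') x)"
    using Poly_Mapping.keys_add[of m m'] by (intro monom_eval_superset) auto
  also have "\<dots> = (\<Prod>x\<in>?S. \<sigma> x ^ Poly_Mapping.lookup m x) * (\<Prod>x\<in>?S. \<sigma> x ^ Poly_Mapping.lookup m' x)"
    by (simp add: lookup_add power_add prod.distrib)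
  also have "\<dots> = monom_eval \<sigma> m * monom_eval \<sigma> m'"
    by (simp add: monom_eval_superset[of ?S])
  finally show ?thesis .
qed

lemma monom_eval_single: "monom_eval \<sigma> (Poly_Mapping.single x e) = \<sigma> x ^ e"
  by (cases "e = 0") (simp_all add: monom_eval_def)

lemma monom_eval_remove:
  "monom_eval \<sigma> m
   = monom_eval \<sigma> (m - Poly_Mapping.single x (Poly_Mapping.lookup m x)) * \<sigma> x ^ Poly_Mapping.lookup m x"
proof -
  have "m = m - Poly_Mapping.single x (Poly_Mapping.lookup m x)
      + Poly_Mapping.single x (Poly_Mapping.lookup m x)"
    by (rule poly_mapping_eqI) (auto simp: lookup_add lookup_minus lookup_single when_def)
  then show ?thesis by (metis monom_eval_add monom_eval_single)
qed

text \<open>After the removal \<open>x\<close> is no longer a key, so its value is immaterial. This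
  lets \<open>P\<close> be evaluated with F(u) for the variable \<open>Xvar 0\<close> while its
  coefficients are evaluated with 0 there.\<close>

lemma monom_eval_update_remove:
  "monom_eval (\<sigma>(x := b)) (m - Poly_Mapping.single x (Poly_Mapping.lookup m x))
   = monom_eval \<sigma> (m - Poly_Mapping.single x (Poly_Mapping.lookup m x))"
  unfolding monom_eval_def
  by (rule prod.cong) (auto simp: in_keys_iff lookup_minus lookup_single)

lemma monom_eval_deriv:
  assumes "Poly_Mapping.lookup m x \<noteq> 0"
  shows "monom_eval \<sigma> (m - Poly_Mapping.single x 1)
   = monom_eval \<sigma> (m - Poly_Mapping.single x (Poly_Mapping.lookup m x)) * \<sigma> x ^ (Poly_Mapping.lookup m x - 1)"
proof -
  have "m - Poly_Mapping.single x 1 = m - Poly_Mapping.single x (Poly_Mapping.lookup m x)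
      + Poly_Mapping.single x (Poly_Mapping.lookup m x - 1)"
    using assms
    by (intro poly_mapping_eqI) (auto simp: lookup_add lookup_minus lookup_single when_def)
  then show ?thesis by (metis monom_eval_add monom_eval_single)
qed

lemma mpoly_eval_superset:
  assumes "finite S" "Poly_Mapping.keys P \<subseteq> S" "h 0 = 0"
  shows "mpoly_eval h \<sigma> P = (\<Sum>m\<in>S. h (Poly_Mapping.lookup P m) * monom_eval \<sigma> m)"
  unfolding mpoly_eval_def monom_eval_def using assms
  by (intro sum.mono_neutral_left) (auto simp: in_keys_iff)

lemma mpoly_sum_singles:
  "P = (\<Sum>m\<in>Poly_Mapping.keys P. Poly_Mapping.single m (Poly_Mapping.lookup P m))"
  by (rule poly_mapping_eqI)
    (auto simp: lookup_sum lookup_single when_def in_keys_iff)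

section \<open>Evaluation as a ring homomorphism, and expansion in powers of one variable\<close>

context
  fixes h :: "'a::comm_ring_1 \<Rightarrow> 'b::comm_ring_1"
  assumes hom: "comm_ring_hom h"
begin

interpretation h: comm_ring_hom h by (rule hom)

lemma mpoly_eval_single: "mpoly_eval h \<sigma> (Poly_Mapping.single m c) = h c * monom_eval \<sigma> m"
  by (subst mpoly_eval_superset[of "{m}"]) auto

lemma mpoly_eval_add: "mpoly_eval h \<sigma> (P + Q) = mpoly_eval h \<sigma> P + mpoly_eval h \<sigma> Q"
proof -
  let ?S = "Poly_Mapping.keys P \<union> Poly_Mapping.keys Q"
  have "mpoly_eval h \<sigma> (P + Q) = (\<Sum>m\<in>?S. h (Poly_Mapping.lookup (P + Q) m) * monom_eval \<sigma> m)"
    using Poly_Mapping.keys_add[of P Q] by (intro mpoly_eval_superset) auto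
  also have "\<dots> = mpoly_eval h \<sigma> P + mpoly_eval h \<sigma> Q"
    by (simp add: mpoly_eval_superset[of ?S] lookup_add h.hom_add distrib_right sum.distrib)
  finally show ?thesis .
qed

lemma mpoly_eval_0: "mpoly_eval h \<sigma> 0 = 0"
  by (simp add: mpoly_eval_def)

lemma mpoly_eval_sum: "mpoly_eval h \<sigma> (\<Sum>i\<in>A. Q i) = (\<Sum>i\<in>A. mpoly_eval h \<sigma> (Q i))"
  by (induction A rule: infinite_finite_induct) (simp_all add: mpoly_eval_0 mpoly_eval_add)

lemma mpoly_eval_mult: "mpoly_eval h \<sigma> (P * Q) = mpoly_eval h \<sigma> P * mpoly_eval h \<sigma> Q"
proof -
  let ?s = "\<lambda>P m. Poly_Mapping.single m (Poly_Mapping.lookup P m)"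
  have "P * Q = (\<Sum>m\<in>Poly_Mapping.keys P. \<Sum>m'\<in>Poly_Mapping.keys Q. ?s P m * ?s Q m')"
    by (subst mpoly_sum_singles[of P], subst mpoly_sum_singles[of Q]) (rule sum_product)
  then have "mpoly_eval h \<sigma> (P * Q)
      = (\<Sum>m\<in>Poly_Mapping.keys P. \<Sum>m'\<in>Poly_Mapping.keys Q.
          (h (Poly_Mapping.lookup P m) * monom_eval \<sigma> m) * (h (Poly_Mapping.lookup Q m') * monom_eval \<sigma> m'))"
    by (simp add: mpoly_eval_sum mult_single mpoly_eval_single monom_eval_add h.hom_mult mult_ac)
  then show ?thesis
    by (simp add: mpoly_eval_superset[OF finite_keys order.refl] sum_product)
qed

lemma comm_ring_hom_mpoly_eval: "comm_ring_hom (mpoly_eval h \<sigma>)"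
proof
  show "mpoly_eval h \<sigma> 1 = 1"
    by (simp add: mpoly_eval_single flip: single_one)
qed (simp_all add: mpoly_eval_add mpoly_eval_mult mpoly_eval_0)

lemma mpoly_eval_coeff:
  "mpoly_eval h (\<sigma>(x := b)) (mpoly_coeff x P j)
   = (\<Sum>m | m \<in> Poly_Mapping.keys P \<and> Poly_Mapping.lookup m x = j.
       h (Poly_Mapping.lookup P m) * monom_eval \<sigma> (m - Poly_Mapping.single x (Poly_Mapping.lookup m x)))"
  unfolding mpoly_coeff_def mpoly_eval_sum mpoly_eval_single
  by (rule sum.cong) (use monom_eval_update_remove[of \<sigma> x b] in auto)

lemma lookup_le_mpoly_degree:
  "m \<in> Poly_Mapping.keys P \<Longrightarrow> Poly_Mapping.lookup m x \<le> mpoly_degree x P"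
  unfolding mpoly_degree_def by (rule Max_ge) auto

text \<open>Monomials are grouped by their exponent of \<open>x\<close>. The coefficients are free
  of \<open>x\<close>, so any \<open>b\<close> may stand for it there; later \<open>b = 0\<close>
  matches the convention of \<open>eval_cat_poly\<close>.\<close>

lemma mpoly_eval_expand:
  "mpoly_eval h \<sigma> P
   = (\<Sum>j\<le>mpoly_degree x P. mpoly_eval h (\<sigma>(x := b)) (mpoly_coeff x P j) * \<sigma> x ^ j)"
proof -
  let ?t = "\<lambda>m. h (Poly_Mapping.lookup P m) *
    monom_eval \<sigma> (m - Poly_Mapping.single x (Poly_Mapping.lookup m x)) * \<sigma> x ^ Poly_Mapping.lookup m x"
  have "mpoly_eval h \<sigma> P = (\<Sum>m\<in>Poly_Mapping.keys P. ?t m)"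
    by (subst mpoly_eval_superset[OF finite_keys order.refl])
      (auto simp: mult.assoc simp flip: monom_eval_remove)
  also have "\<dots> = (\<Sum>j\<le>mpoly_degree x P.
      \<Sum>m | m \<in> Poly_Mapping.keys P \<and> Poly_Mapping.lookup m x = j. ?t m)"
    by (rule sum.group[symmetric]) (auto intro: lookup_le_mpoly_degree)
  also have "\<dots> = (\<Sum>j\<le>mpoly_degree x P. mpoly_eval h (\<sigma>(x := b)) (mpoly_coeff x P j) * \<sigma> x ^ j)"
    unfolding mpoly_eval_coeff sum_distrib_right by (intro sum.cong) auto
  finally show ?thesis .
qed

lemma mpoly_eval_deriv_expand:
  "mpoly_eval h \<sigma> (mpoly_deriv x P)
   = (\<Sum>j\<le>mpoly_degree x P.
       of_nat j * mpoly_eval h (\<sigma>(x := b)) (mpoly_coeff x P j) * \<sigma> x ^ (j - 1))"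
proof -
  let ?t = "\<lambda>m. of_nat (Poly_Mapping.lookup m x) * (h (Poly_Mapping.lookup P m) *
    monom_eval \<sigma> (m - Poly_Mapping.single x (Poly_Mapping.lookup m x))) * \<sigma> x ^ (Poly_Mapping.lookup m x - 1)"
  have t: "mpoly_eval h \<sigma> (Poly_Mapping.single (m - Poly_Mapping.single x 1)
      (of_nat (Poly_Mapping.lookup m x) * Poly_Mapping.lookup P m)) = ?t m" for m
    by (cases "Poly_Mapping.lookup m x = 0")
      (auto simp: mpoly_eval_single mpoly_eval_0 monom_eval_deriv[unfolded One_nat_def]
        h.hom_mult h.hom_of_nat mult_ac)
  have "mpoly_eval h \<sigma> (mpoly_deriv x P) = (\<Sum>m\<in>Poly_Mapping.keys P. ?t m)"
    unfolding mpoly_deriv_def mpoly_eval_sum t ..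
  also have "\<dots> = (\<Sum>j\<le>mpoly_degree x P.
      \<Sum>m | m \<in> Poly_Mapping.keys P \<and> Poly_Mapping.lookup m x = j. ?t m)"
    by (rule sum.group[symmetric]) (auto intro: lookup_le_mpoly_degree)
  also have "\<dots> = (\<Sum>j\<le>mpoly_degree x P.
       of_nat j * mpoly_eval h (\<sigma>(x := b)) (mpoly_coeff x P j) * \<sigma> x ^ (j - 1))"
    unfolding mpoly_eval_coeff sum_distrib_right sum_distrib_left by (intro sum.cong) auto
  finally show ?thesis .
qed

text \<open>A ring homomorphism commutes with determinants. The size of the matrix is fixed by the
  degree of \<open>P\<close> before evaluation, so nothing changes if the leading coefficient
  evaluates to 0.\<close>

lemma mpoly_eval_disc:
  "mpoly_eval h \<sigma> (mpoly_disc x P) =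
     (let n = mpoly_degree x P in
       (-1) ^ (n * (n - 1) div 2) * det (disc_mat n (\<lambda>j. mpoly_eval h \<sigma> (mpoly_coeff x P j))))"
proof -
  interpret e: comm_ring_hom "mpoly_eval h \<sigma>" by (rule comm_ring_hom_mpoly_eval)
  have "map_mat (mpoly_eval h \<sigma>) (disc_mat n c) = disc_mat n (\<lambda>j. mpoly_eval h \<sigma> (c j))" for n c
    by (rule eq_matI) (auto simp: disc_mat_def Let_def e.hom_mult e.hom_of_nat simp del: of_nat_diff)
  then show ?thesis
    by (simp add: mpoly_disc_def Let_def e.hom_mult e.hom_power e.hom_uminus flip: e.hom_det)
qed

text \<open>This is \<open>square_dvd_det_disc_mat\<close> for the root
  \<open>f = \<sigma> x\<close> of the polynomial in \<open>x\<close> obtained by evaluating the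
  coefficients of \<open>P\<close>.\<close>

lemma square_dvd_mpoly_eval_disc:
  assumes "mpoly_degree x P \<ge> 2" "mpoly_eval h \<sigma> P = 0"
  shows "(mpoly_eval h \<sigma> (mpoly_deriv x P))\<^sup>2 dvd mpoly_eval h (\<sigma>(x := b)) (mpoly_disc x P)"
proof -
  let ?a = "\<lambda>j. mpoly_eval h (\<sigma>(x := b)) (mpoly_coeff x P j)"
  have "(\<Sum>j\<le>mpoly_degree x P. ?a j * \<sigma> x ^ j) = 0"
    using mpoly_eval_expand[of \<sigma> P x b] assms(2) by (rule trans[OF sym])
  from square_dvd_det_disc_mat[OF assms(1) this] show ?thesis
    unfolding mpoly_eval_deriv_expand[of \<sigma> x P b] mpoly_eval_disc Let_def by (rule dvd_mult)
qed

end

section \<open>Change of ring and formal derivatives\<close>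

lemma mpoly_eval_hom:
  assumes "comm_ring_hom g"
  shows "g (mpoly_eval h \<sigma> P) = mpoly_eval (\<lambda>c. g (h c)) (\<lambda>x. g (\<sigma> x)) P"
proof -
  interpret comm_ring_hom g by (rule assms)
  show ?thesis by (simp add: mpoly_eval_def hom_sum hom_mult hom_prod hom_power)
qed

lemma comm_ring_hom_const_poly: "comm_ring_hom (\<lambda>c::'a::comm_ring_1. [:c:])"
  by standard simp_all

lemma comm_ring_hom_comp:
  assumes "comm_ring_hom f" "comm_ring_hom g"
  shows "comm_ring_hom (\<lambda>x. f (g x))"
proof -
  interpret f: comm_ring_hom f by fact
  interpret g: comm_ring_hom g by fact
  show ?thesis by standard (simp_all add: f.hom_add g.hom_add f.hom_mult g.hom_mult)
qed

text \<open>Expanded in powers of \<open>x\<close>, the polynomial has constant coefficients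
  \<open>[:c j:]\<close>, so both sides reduce to the derivative of \<open>monom\<close>.\<close>

lemma pderiv_mpoly_eval:
  fixes h :: "'a::comm_ring_1 \<Rightarrow> 'b::idom"
  assumes h: "comm_ring_hom h" and x: "\<sigma> x = [:0, 1:]" and y: "\<And>y. y \<noteq> x \<Longrightarrow> \<sigma> y = [:s y:]"
  shows "pderiv (mpoly_eval (\<lambda>c. [:h c:]) \<sigma> Q) = mpoly_eval (\<lambda>c. [:h c:]) \<sigma> (mpoly_deriv x Q)"
proof -
  note hom = comm_ring_hom_comp[OF comm_ring_hom_const_poly h]
  define c where "c = (\<lambda>j. mpoly_eval h (s(x := 0)) (mpoly_coeff x Q j))"
  \<comment> \<open>With \<open>x\<close> sent to 0 every variable has a constant value, so the
    coefficients evaluate to constants.\<close>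
  have "\<sigma>(x := 0) = (\<lambda>y. [:(s(x := 0)) y:])" using y by auto
  then have c: "mpoly_eval (\<lambda>c. [:h c:]) (\<sigma>(x := 0)) (mpoly_coeff x Q j) = [:c j:]" for j
    unfolding c_def using mpoly_eval_hom[OF comm_ring_hom_const_poly, of h "s(x := 0)"] by simp
  have "mpoly_eval (\<lambda>c. [:h c:]) \<sigma> Q = (\<Sum>j\<le>mpoly_degree x Q. monom (c j) j)"
    unfolding mpoly_eval_expand[OF hom, of \<sigma> Q x 0] c x by (simp add: monom_altdef)
  moreover have "mpoly_eval (\<lambda>c. [:h c:]) \<sigma> (mpoly_deriv x Q)
      = (\<Sum>j\<le>mpoly_degree x Q. monom (of_nat j * c j) (j - 1))"
    unfolding mpoly_eval_deriv_expand[OF hom, of \<sigma> x Q 0] c x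
    by (simp add: monom_altdef of_nat_poly mult.commute)
  ultimately show ?thesis by (simp add: pderiv_sum pderiv_monom)
qed

text \<open>By the product rule one derivative costs at most one factor.\<close>

lemma power_dvd_pderiv:
  fixes p q :: "'a::idom poly"
  assumes "p ^ m dvd q"
  shows "p ^ (m - 1) dvd pderiv q"
proof (cases m)
  case (Suc k)
  then obtain r where "q = p ^ Suc k * r" using assms unfolding Suc dvd_def by blast
  then have "pderiv q = p ^ k * (p * pderiv r + smult (of_nat (Suc k)) (r * pderiv p))"
    by (simp only: pderiv_mult pderiv_power_Suc) (simp add: algebra_simps del: of_nat_Suc)
  then show ?thesis using Suc by simp
qed simp


section \<open>Rings of fractional power series\<close>

lemma fps_at_0 [simp]: "fps_at d 0 = 0"
  by (rule fps_ext) (simp add: fps_at_def zero_frps.rep_eq)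

lemma fps_at_eq_0_iff:
  assumes "has_den d (frps_nth f)"
  shows "fps_at d f = 0 \<longleftrightarrow> f = 0"
proof -
  have "has_den d (frps_nth (0 :: 'a frps))"
    using has_den_pos[OF assms] by (simp add: has_den_def zero_frps.rep_eq)
  then show ?thesis using fps_at_eqI[OF assms, of 0] by auto
qed

text \<open>With a common denominator \<open>d\<close>, two series become ordinary power series in
  t^(1/d), which have no zero divisors. Cancellation of powers of u - U and the use of
  \<open>pderiv\<close> over these series rest on this.\<close>

instance frps :: (idom) idom
proof
  fix a b :: "'a frps"
  assume ab: "a \<noteq> 0" "b \<noteq> 0"
  obtain d where d: "has_den d (frps_nth a)" "has_den d (frps_nth b)" using common_den2 by blast
  have "fps_at d (a * b) \<noteq> 0"
    using ab by (simp add: fps_at_mult d fps_at_eq_0_iff)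
  then show "a * b \<noteq> 0" by auto
qed

lemma frps_const_0 [simp]: "frps_const 0 = 0"
  by transfer auto

lemma has_den_frps_of_fps: "has_den 1 (frps_nth (frps_of_fps h f))"
  by transfer (auto simp: has_den_def Nats_def)

lemma fps_at_frps_of_fps: "fps_at 1 (frps_of_fps h f) = Abs_fps (\<lambda>n. h (fps_nth f n))"
  by (rule fps_ext) (simp add: fps_at_def frps_of_fps.rep_eq)

lemma frps_of_fps_const: "h 0 = 0 \<Longrightarrow> frps_of_fps h (fps_const c) = frps_const (h c)"
  by transfer (auto simp: fun_eq_iff Nats_def)

lemma comm_ring_hom_frps_of_fps:
  fixes h :: "'a::comm_ring_1 \<Rightarrow> 'b::comm_ring_1"
  assumes "comm_ring_hom h"
  shows "comm_ring_hom (frps_of_fps h)"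
proof -
  interpret comm_ring_hom h by fact
  have add: "frps_of_fps h (f + g) = frps_of_fps h f + frps_of_fps h g" for f g
    by (simp add: frps_nth_inject[symmetric] fun_eq_iff plus_frps.rep_eq frps_of_fps.rep_eq hom_add)
  have mult: "frps_of_fps h (f * g) = frps_of_fps h f * frps_of_fps h g" for f g
    by (intro fps_at_eqI[of 1] fps_ext has_den_frps_mult has_den_frps_of_fps)
      (simp add: fps_at_mult has_den_frps_of_fps fps_at_frps_of_fps fps_mult_nth hom_sum hom_mult
        del: One_nat_def)
  have one: "frps_of_fps h 1 = 1"
    using frps_of_fps_const[of h 1] by (simp add: one_frps_def)
  have zero: "frps_of_fps h 0 = 0"
    using frps_of_fps_const[of h 0] by simp
  show ?thesis by standard (simp_all add: add mult one zero)
qed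

lemma has_den_frps_to_poly: "has_den d (frps_nth f) \<Longrightarrow> has_den d (frps_nth (frps_to_poly f))"
  by transfer (auto simp: has_den_def)

lemma fps_at_frps_to_poly: "fps_at d (frps_to_poly f) = Abs_fps (\<lambda>n. [:fps_nth (fps_at d f) n:])"
  by (rule fps_ext) (simp add: fps_at_def frps_to_poly.rep_eq)

lemma frps_to_poly_const: "frps_to_poly (frps_const c) = frps_const [:c:]"
  by transfer (auto simp: fun_eq_iff)

lemma comm_ring_hom_frps_to_poly:
  "comm_ring_hom (frps_to_poly :: 'a::comm_ring_1 frps \<Rightarrow> _)"
proof -
  interpret c: comm_ring_hom "\<lambda>c::'a. [:c:]" by (rule comm_ring_hom_const_poly)
  have add: "frps_to_poly (f + g) = frps_to_poly f + frps_to_poly g" for f g :: "'a frps"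
    by transfer (auto simp: fun_eq_iff)
  have mult: "frps_to_poly (f * g) = frps_to_poly f * frps_to_poly g" for f g :: "'a frps"
  proof -
    obtain d where d: "has_den d (frps_nth f)" "has_den d (frps_nth g)" using common_den2 by blast
    have "fps_at d (frps_to_poly (f * g)) = fps_at d (frps_to_poly f * frps_to_poly g)"
      by (rule fps_ext) (simp add: fps_at_mult has_den_frps_to_poly d fps_at_frps_to_poly
          fps_mult_nth c.hom_sum[symmetric] mult.commute)
    then show ?thesis
      by (intro fps_at_eqI[of d]) (simp_all add: d has_den_frps_mult has_den_frps_to_poly)
  qed
  have one: "frps_to_poly (1 :: 'a frps) = 1"
    by (simp add: one_frps_def frps_to_poly_const)
  have zero: "frps_to_poly (0 :: 'a frps) = 0"
    using frps_to_poly_const[of "0::'a"] by simp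
  show ?thesis by standard (simp_all add: add mult one zero)
qed

lemma frps_to_poly_frps_of_fps:
  "frps_to_poly (frps_of_fps h f) = frps_of_fps (\<lambda>c. [:h c:]) f"
  by transfer (auto simp: fun_eq_iff)

lemma frps_of_fps_cong:
  "(\<And>n. h (fps_nth f n) = h' (fps_nth f' n)) \<Longrightarrow> frps_of_fps h f = frps_of_fps h' f'"
  by transfer (auto simp: fun_eq_iff)

text \<open>The \<open>u\<close>-degree of the lowest nonzero coefficient of a multiple of \<open>u - U\<close> is positive.\<close>

lemma frps_to_poly_eq_mult_linear_imp_0:
  fixes U c :: "'a::idom frps"
  assumes eq: "frps_to_poly c = (frps_const [:0, 1:] - frps_to_poly U) * S"
  shows "c = 0"
proof -
  interpret p: comm_ring_hom "frps_to_poly :: 'a frps \<Rightarrow> _" by (rule comm_ring_hom_frps_to_poly)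
  obtain d1 where d1: "has_den d1 (frps_nth U)" "has_den d1 (frps_nth c)" using common_den2 by blast
  obtain d2 where d2: "has_den d2 (frps_nth S)" using frps_nth[of S] by auto
  define d where "d = d1 * d2"
  have d: "has_den d (frps_nth U)" "has_den d (frps_nth c)" "has_den d (frps_nth S)"
    unfolding d_def using has_den_mult_left[OF d1(1) has_den_pos[OF d2]]
      has_den_mult_left[OF d1(2) has_den_pos[OF d2]] has_den_mult_right[OF d2 has_den_pos[OF d1(1)]]
    by blast+
  let ?W = "frps_const [:0, 1:] + frps_to_poly (- U)"
  have dU: "has_den d (frps_nth (- U))"
    using has_den_uminus[OF d(1)] by (simp add: uminus_frps.rep_eq)
  then have dW: "has_den d (frps_nth ?W)"
    by (intro has_den_frps_add has_den_frps_const has_den_frps_to_poly has_den_pos[OF d(1)])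
  have "frps_to_poly c = ?W * S" using eq by (simp add: p.hom_uminus)
  then have prod: "fps_at d (frps_to_poly c) = fps_at d ?W * fps_at d S"
    using fps_at_mult[OF dW d(3)] by simp
  have co: "[:fps_nth (fps_at d c) n:]
      = (\<Sum>i=0..n. fps_nth (fps_at d ?W) i * fps_nth (fps_at d S) (n - i))" for n
    unfolding fps_mult_nth[symmetric] by (simp add: fps_at_frps_to_poly flip: prod)
  \<comment> \<open>At t^0 the factor u - U is monic of degree 1 in u.\<close>
  have W0: "fps_nth (fps_at d ?W) 0 = [:fps_nth (fps_at d (- U)) 0, 1:]"
    by (simp add: fps_at_add fps_at_frps_to_poly fps_at_const has_den_pos[OF d(1)])
  \<comment> \<open>When all lower coefficients of \<open>S\<close> vanish, only the constant term
    of \<open>?W\<close> meets the n-th one. The product is constant in u, whereas a nonzero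
    coefficient of \<open>S\<close> would give it positive degree.\<close>
  have "fps_nth (fps_at d S) n = 0" for n
  proof (induction n rule: less_induct)
    case (less n)
    have "[:fps_nth (fps_at d c) n:] = fps_nth (fps_at d ?W) 0 * fps_nth (fps_at d S) n"
      unfolding co using less by (subst sum.atLeast_Suc_atMost) (auto intro!: sum.neutral)
    then have "degree ([:fps_nth (fps_at d (- U)) 0, 1:] * fps_nth (fps_at d S) n) = 0"
      unfolding W0[symmetric] by (metis degree_pCons_0)
    moreover have "degree ([:fps_nth (fps_at d (- U)) 0, 1:] * fps_nth (fps_at d S) n) > 0"
      if "fps_nth (fps_at d S) n \<noteq> 0"
      using that by (subst degree_mult_eq) auto
    ultimately show ?case by force
  qed
  then have "fps_at d S = 0" by (intro fps_ext) simp
  then have "S = 0" using fps_at_eq_0_iff[OF d(3)] by blast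
  then have "frps_to_poly c = 0" using eq by simp
  then have "fps_at d (frps_to_poly c) = 0" by simp
  then have "[:fps_nth (fps_at d c) n:] = 0" for n
    unfolding fps_at_frps_to_poly by (metis fps_nth_Abs_fps fps_zero_nth)
  then have "fps_at d c = 0" by (intro fps_ext) simp
  then show ?thesis using fps_at_eq_0_iff[OF d(2)] by blast
qed

text \<open>The canonical map from polynomials in v over fractional series to
  \<open>L[u]\<^sup>f\<^sup>r[[t]]\<close>, with v sent to u. In the target the degree in u may be
  unbounded, so a quotient found there is not a priori a polynomial in v.\<close>

definition frps_of_poly :: "'a::comm_ring_1 frps poly \<Rightarrow> 'a poly frps" where
  "frps_of_poly D = poly (map_poly frps_to_poly D) (frps_const [:0, 1:])"

lemma comm_ring_hom_frps_of_poly: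
  "comm_ring_hom (frps_of_poly :: 'a::comm_ring_1 frps poly \<Rightarrow> _)"
proof -
  interpret p: comm_ring_hom "frps_to_poly :: 'a frps \<Rightarrow> _" by (rule comm_ring_hom_frps_to_poly)
  interpret mp: map_poly_comm_ring_hom "frps_to_poly :: 'a frps \<Rightarrow> _" ..
  show ?thesis
    by standard (simp_all add: frps_of_poly_def mp.hom_add mp.hom_mult)
qed

lemma frps_of_poly_const:
  fixes c :: "'a::comm_ring_1 frps"
  shows "frps_of_poly [:c:] = frps_to_poly c"
proof -
  interpret p: comm_ring_hom "frps_to_poly :: 'a frps \<Rightarrow> _" by (rule comm_ring_hom_frps_to_poly)
  show ?thesis by (simp add: frps_of_poly_def Polynomial.map_poly_pCons)
qed

lemma frps_of_poly_linear:
  fixes c :: "'a::comm_ring_1 frps"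
  shows "frps_of_poly [:c, 1:] = frps_const [:0, 1:] + frps_to_poly c"
proof -
  interpret p: comm_ring_hom "frps_to_poly :: 'a frps \<Rightarrow> _" by (rule comm_ring_hom_frps_to_poly)
  show ?thesis by (simp add: frps_of_poly_def Polynomial.map_poly_pCons)
qed

text \<open>Divisibility descends from series to polynomials: the factors are split off one at a
  time by synthetic division, and each remainder is forced to vanish.\<close>

lemma linear_power_dvd_of_frps_of_poly:
  fixes U :: "'a::idom frps"
  assumes "(frps_const [:0, 1:] - frps_to_poly U) ^ m dvd frps_of_poly D"
  shows "[:- U, 1:] ^ m dvd D"
proof -
  interpret p: comm_ring_hom "frps_to_poly :: 'a frps \<Rightarrow> _" by (rule comm_ring_hom_frps_to_poly)
  interpret q: comm_ring_hom "frps_of_poly :: 'a frps poly \<Rightarrow> _" by (rule comm_ring_hom_frps_of_poly)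
  let ?w = "frps_const [:0, 1:] - frps_to_poly U"
  have lin: "frps_of_poly [:- U, 1:] = ?w"
    by (simp add: frps_of_poly_linear p.hom_uminus)
  \<comment> \<open>Needed to cancel \<open>?w ^ m\<close> in the domain of series; the coefficient
    at t^0 has leading term u.\<close>
  have w: "?w \<noteq> 0"
  proof -
    have "frps_nth ?w 0 = [:- frps_nth U 0, 1:]"
      unfolding minus_frps_def plus_frps.rep_eq uminus_frps.rep_eq frps_const.rep_eq
        frps_to_poly.rep_eq by simp
    then show ?thesis by (auto simp: zero_frps.rep_eq)
  qed
  show ?thesis using assms
  proof (induction m)
    case (Suc m)
    have "?w ^ m dvd frps_of_poly D"
      by (rule dvd_trans[OF le_imp_power_dvd Suc.prems]) simp
    then have "[:- U, 1:] ^ m dvd D" by (rule Suc.IH)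
    then obtain q where D: "D = [:- U, 1:] ^ m * q" by (rule dvdE)
    obtain s where "frps_of_poly D = ?w ^ Suc m * s"
      using Suc.prems by (rule dvdE)
    then have "?w ^ m * frps_of_poly q = ?w ^ m * (?w * s)"
      unfolding D by (simp add: q.hom_mult q.hom_power lin mult_ac)
    then have s: "frps_of_poly q = ?w * s" using w by simp
    \<comment> \<open>The remainder \<open>poly q U\<close> does not involve v, and its image is a
      multiple of u - U, so it is 0.\<close>
    have q: "q = [:- U, 1:] * synthetic_div q U + [:poly q U:]"
      using synthetic_div_correct'[of U q] by simp
    have "frps_of_poly q = ?w * frps_of_poly (synthetic_div q U) + frps_to_poly (poly q U)"
      by (subst q) (simp only: q.hom_add q.hom_mult lin frps_of_poly_const)
    then have "frps_to_poly (poly q U) = ?w * (s - frps_of_poly (synthetic_div q U))"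
      using s by (simp add: algebra_simps)
    then have "poly q U = 0" by (rule frps_to_poly_eq_mult_linear_imp_0)
    then have "[:- U, 1:] dvd q" by (simp add: poly_eq_0_iff_dvd)
    then show ?case unfolding D power_Suc2 by (rule mult_dvd_mono[OF dvd_refl])
  qed simp
qed


section \<open>Specialisation of the discriminant\<close>

lemma comm_ring_hom_to_ac: "comm_ring_hom (to_ac :: 'a::field \<Rightarrow> _)"
  by standard simp_all

lemma comm_ring_hom_frps_const: "comm_ring_hom (frps_const :: 'a::comm_ring_1 \<Rightarrow> _)"
proof -
  interpret f: comm_ring_hom "frps_of_fps (\<lambda>x::'a. x)"
    by (rule comm_ring_hom_frps_of_fps) (unfold_locales, simp_all)
  have c: "frps_const (c::'a) = frps_of_fps (\<lambda>x. x) (fps_const c)" for c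
    by (simp add: frps_of_fps_const)
  show ?thesis
    by standard (simp_all add: c f.hom_add f.hom_mult flip: fps_const_add fps_const_mult)
qed

text \<open>A common target for both evaluations: \<open>eval_at_series\<close> after extension to
  the closure, and \<open>eval_cat_poly\<close> after \<open>frps_of_poly\<close>, differ there only
  in the value of \<open>Xvar 0\<close>.\<close>

definition series_assign ::
  "'a poly fps \<Rightarrow> (nat \<Rightarrow> 'a::field fps) \<Rightarrow> ctvar \<Rightarrow> 'a alg_closure poly frps" where
  "series_assign F Fs = assign (frps_of_fps (map_poly to_ac) F)
     (\<lambda>i. frps_to_poly (frps_of_fps to_ac (Fs i))) frps_t (frps_const [:0, 1:])"

lemma frps_of_fps_eval_at_series:
  fixes Fs :: "nat \<Rightarrow> 'a::field fps"
  shows "frps_of_fps (map_poly to_ac) (eval_at_series F Fs Q)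
       = mpoly_eval (\<lambda>c. frps_const [:to_ac c:]) (series_assign F Fs) Q"
proof -
  interpret a: comm_ring_hom "to_ac :: 'a \<Rightarrow> _" by (rule comm_ring_hom_to_ac)
  interpret ma: map_poly_comm_ring_hom "to_ac :: 'a \<Rightarrow> _" ..
  have X: "frps_of_fps (map_poly to_ac) (fps_X :: 'a poly fps) = frps_t"
    by (rule frps_of_fps_cong) (simp add: fps_X_def)
  have "(\<lambda>x. frps_of_fps (map_poly to_ac) (assign F (\<lambda>i. Abs_fps (\<lambda>n. [:fps_nth (Fs i) n:])) fps_X
      (fps_const [:0, 1:]) x)) = series_assign F Fs"
  proof
    fix x
    show "frps_of_fps (map_poly to_ac) (assign F (\<lambda>i. Abs_fps (\<lambda>n. [:fps_nth (Fs i) n:])) fps_X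
      (fps_const [:0, 1:]) x) = series_assign F Fs x"
      by (cases x) (auto simp: series_assign_def X frps_of_fps_const frps_to_poly_frps_of_fps
          Polynomial.map_poly_pCons intro!: frps_of_fps_cong)
  qed
  then show ?thesis
    unfolding eval_at_series_def
    by (subst mpoly_eval_hom[OF comm_ring_hom_frps_of_fps[OF ma.comm_ring_hom_axioms]])
      (simp add: frps_of_fps_const Polynomial.map_poly_pCons)
qed

text \<open>The series \<open>F\<close> is arbitrary here because the update overwrites its only
  occurrence.\<close>

lemma frps_of_poly_eval_cat_poly:
  fixes Fs :: "nat \<Rightarrow> 'a::field fps"
  shows "frps_of_poly (eval_cat_poly Fs Q)
       = mpoly_eval (\<lambda>c. frps_const [:to_ac c:]) ((series_assign F Fs)(Xvar 0 := 0)) Q"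
proof -
  interpret q: comm_ring_hom "frps_of_poly :: 'a alg_closure frps poly \<Rightarrow> _"
    by (rule comm_ring_hom_frps_of_poly)
  have X: "frps_to_poly (frps_t :: 'a alg_closure frps) = frps_t"
    unfolding frps_to_poly_frps_of_fps by (rule frps_of_fps_cong) (simp add: fps_X_def)
  interpret p: comm_ring_hom "frps_to_poly :: 'a alg_closure frps \<Rightarrow> _"
    by (rule comm_ring_hom_frps_to_poly)
  have "(\<lambda>x. frps_of_poly (assign 0 (\<lambda>i. [:frps_of_fps to_ac (Fs i):]) [:frps_t:] [:0, 1:] x))
      = (series_assign F Fs)(Xvar 0 := 0)"
  proof
    fix x
    show "frps_of_poly (assign 0 (\<lambda>i. [:frps_of_fps to_ac (Fs i):]) [:frps_t:] [:0, 1:] x)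
      = ((series_assign F Fs)(Xvar 0 := 0)) x"
      by (cases x) (auto simp: series_assign_def X frps_of_poly_const frps_of_poly_linear)
  qed
  then show ?thesis
    unfolding eval_cat_poly_def
    by (subst mpoly_eval_hom[OF q.comm_ring_hom_axioms])
      (simp add: frps_of_poly_const frps_to_poly_const)
qed

lemma comm_ring_hom_eval: "comm_ring_hom (\<lambda>D. poly D (a::'a::comm_ring_1))"
  by unfold_locales simp_all

lemma eval_cat_conv_poly:
  fixes Fs :: "nat \<Rightarrow> 'a::field fps"
  shows "eval_cat Fs U Q = poly (eval_cat_poly Fs Q) U"
proof -
  have assign_U: "(\<lambda>x. poly (assign 0 (\<lambda>i. [:frps_of_fps to_ac (Fs i):]) [:frps_t:] [:0, 1:] x) U)
      = assign 0 (\<lambda>i. frps_of_fps to_ac (Fs i)) frps_t U"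
  proof
    fix x
    show "poly (assign 0 (\<lambda>i. [:frps_of_fps to_ac (Fs i):]) [:frps_t:] [:0, 1:] x) U
      = assign 0 (\<lambda>i. frps_of_fps to_ac (Fs i)) frps_t U x"
      by (cases x) simp_all
  qed
  have "poly (eval_cat_poly Fs Q) U = mpoly_eval (\<lambda>c. poly [:frps_const (to_ac c):] U)
    (\<lambda>x. poly (assign 0 (\<lambda>i. [:frps_of_fps to_ac (Fs i):]) [:frps_t:] [:0, 1:] x) U) Q"
    unfolding eval_cat_poly_def by (rule mpoly_eval_hom[OF comm_ring_hom_eval])
  then show ?thesis unfolding assign_U by (simp add: eval_cat_def)
qed

lemma eval_cat_poly_deriv:
  fixes Fs :: "nat \<Rightarrow> 'a::field fps"
  shows "eval_cat_poly Fs (mpoly_deriv Vvar Q) = pderiv (eval_cat_poly Fs Q)"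
  unfolding eval_cat_poly_def
proof (rule pderiv_mpoly_eval[symmetric])
  show "comm_ring_hom (\<lambda>c::'a. frps_const (to_ac c))"
    by (rule comm_ring_hom_comp[OF comm_ring_hom_frps_const comm_ring_hom_to_ac])
  fix y assume "y \<noteq> Vvar"
  then show "assign 0 (\<lambda>i. [:frps_of_fps to_ac (Fs i):]) [:frps_t:] [:0, 1:] y
      = [:assign 0 (\<lambda>i. frps_of_fps to_ac (Fs i)) frps_t 0 y:]"
    by (cases y) simp_all
qed simp

theorem theorem6p1:
  fixes P :: "'a::field_char_0 mpoly" and k l :: nat
    and Fs :: "nat \<Rightarrow> 'a fps" and F :: "'a poly fps"
    and U :: "'a alg_closure frps"
  assumes vars: "mpoly_vars P \<subseteq> Xvar ` {0..k} \<union> {Tvar, Vvar}"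
    and eq: "eval_at_series F Fs P = 0"
    and mult: "l \<ge> 1"
    and root: "frps_root_of_mult
      (frps_of_fps (map_poly to_ac) (eval_at_series F Fs (mpoly_deriv (Xvar 0) P))) U l"
    and deg: "mpoly_degree (Xvar 0) P \<ge> 2"
  shows "[:- U, 1:] ^ (2 * l) dvd eval_cat_poly Fs (mpoly_disc (Xvar 0) P) \<and>
    (\<forall>i \<le> 2 * l - 1. eval_cat Fs U ((mpoly_deriv Vvar ^^ i) (mpoly_disc (Xvar 0) P)) = 0)"
proof -
  let ?h = "\<lambda>c::'a. frps_const [:to_ac c:]"
  let ?\<sigma> = "series_assign F Fs"
  let ?w = "frps_const [:0, 1:] - frps_to_poly U"
  let ?D = "mpoly_disc (Xvar 0) P"
  have h: "comm_ring_hom ?h"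
    by (rule comm_ring_hom_comp[OF comm_ring_hom_frps_const
          comm_ring_hom_comp[OF comm_ring_hom_const_poly comm_ring_hom_to_ac]])
  \<comment> \<open>The equation \<open>eq\<close> carried to the closure: F(u) is a root of
    \<open>P\<close> with its other variables specialised.\<close>
  have "mpoly_eval ?h ?\<sigma> P = frps_of_fps (map_poly to_ac) 0"
    using frps_of_fps_eval_at_series[of F Fs P] unfolding eq by (rule sym)
  also have "\<dots> = 0"
    by transfer (auto simp: fun_eq_iff)
  finally have disc: "(mpoly_eval ?h ?\<sigma> (mpoly_deriv (Xvar 0) P))\<^sup>2 dvd frps_of_poly (eval_cat_poly Fs ?D)"
    unfolding frps_of_poly_eval_cat_poly[of Fs _ F]
    by (rule square_dvd_mpoly_eval_disc[OF h deg])
  have "?w ^ l dvd mpoly_eval ?h ?\<sigma> (mpoly_deriv (Xvar 0) P)"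
    using root by (auto simp: frps_root_of_mult_def frps_of_fps_eval_at_series)
  then have "?w ^ (2 * l) dvd (mpoly_eval ?h ?\<sigma> (mpoly_deriv (Xvar 0) P))\<^sup>2"
    unfolding power_even_eq by (rule dvd_power_same)
  \<comment> \<open>Back from series in t with coefficients in \<open>L[u]\<close> to polynomials in
    v.\<close>
  from dvd_trans[OF this disc] have dvd: "[:- U, 1:] ^ (2 * l) dvd eval_cat_poly Fs ?D"
    by (rule linear_power_dvd_of_frps_of_poly)
  \<comment> \<open>Differentiation in v becomes \<open>pderiv\<close>, so the i-th derivative keeps
    at least \<open>2 * l - i\<close> factors.\<close>
  have "[:- U, 1:] ^ (2 * l - i) dvd eval_cat_poly Fs ((mpoly_deriv Vvar ^^ i) ?D)" for i
  proof (induction i)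
    case (Suc i)
    then show ?case using power_dvd_pderiv[OF Suc] by (simp add: eval_cat_poly_deriv)
  qed (simp add: dvd)
  \<comment> \<open>As \<open>l \<ge> 1\<close>, the bound \<open>2 * l - 1\<close> is not
    truncated, so at least one factor is left.\<close>
  moreover have "[:- U, 1:] dvd [:- U, 1:] ^ (2 * l - i)" if "i \<le> 2 * l - 1" for i
    using that mult by (intro dvd_power disjI1) linarith
  ultimately have "poly (eval_cat_poly Fs ((mpoly_deriv Vvar ^^ i) ?D)) U = 0"
    if "i \<le> 2 * l - 1" for i
    using that unfolding poly_eq_0_iff_dvd by (blast intro: dvd_trans)
  with dvd show ?thesis by (simp add: eval_cat_conv_poly)
qed

end
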